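(* Let $h$ and $w$ be any positive real numbers. Then $$\lim_{\sigma\downarrow0}\,\frac1{\sigma^2}\,\sup\big\{\operatorname{\mathsf{E}}_{h,w}X\colon \operatorname{\mathsf{E}} X^2=\sigma^2,\ X\text{ is symmetric}\big\}=\frac{\sinh (hw)}{w},$$ where, for each $\sigma>0$, the supremum is taken over all symmetric real-valued random variables $X$ with $\operatorname{\mathsf{E}} X^2=\sigma^2$.
   Context: For real $h>0$, $w>0$ and a real-valued random variable $X$ with finite second moment, the mean of the Winsorised-tilted distribution of $X$ is $$\operatorname{\mathsf{E}}_{h,w}X:=\frac{\operatorname{\mathsf{E}} \big[X e^{h(X\wedge w)}\big]}{\operatorname{\mathsf{E}} \big[e^{h(X\wedge w)}\big]},$$ where $X\wedge w:=\min(X,w)$ and $\operatorname{\mathsf{E}}$ denotes expectation. A real-valued random variable $X$ is called symmetric if $X$ and $-X$ have the same distribution. *)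

theory Defs
  imports "HOL-Probability.Probability"
begin

definition winsor_tilted_mean :: "real \<Rightarrow> real \<Rightarrow> 'a measure \<Rightarrow> ('a \<Rightarrow> real) \<Rightarrow> real" where
  "winsor_tilted_mean h w M X =
     (\<integral>\<omega>. X \<omega> * exp (h * min (X \<omega>) w) \<partial>M) / (\<integral>\<omega>. exp (h * min (X \<omega>) w) \<partial>M)"

definition symmetric_rv :: "'a measure \<Rightarrow> ('a \<Rightarrow> real) \<Rightarrow> bool" where
  "symmetric_rv M X \<longleftrightarrow> X \<in> borel_measurable M \<and> distr M borel X = distr M borel (\<lambda>\<omega>. - X \<omega>)"

text \<open>Integrability of the square is explicit because the Bochner integral of a
  non-integrable function is 0.\<close>

definition symmetric_rv_with_second_moment :: "real \<Rightarrow> 'a measure \<Rightarrow> ('a \<Rightarrow> real) \<Rightarrow> bool" where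
  "symmetric_rv_with_second_moment s M X \<longleftrightarrow>
     prob_space M \<and> symmetric_rv M X \<and>
     integrable M (\<lambda>\<omega>. (X \<omega>)\<^sup>2) \<and> (\<integral>\<omega>. (X \<omega>)\<^sup>2 \<partial>M) = s"

text \<open>The random variables may live on any probability space, but a set comprehension cannot
  range over all sample-space types, so the sample space is taken to be a subset of the reals.
  The lemma below shows that this loses nothing. The supremum is taken in the extended reals,
  so that it is meaningful without knowing that the set is nonempty and bounded.\<close>

definition winsor_tilted_means :: "real \<Rightarrow> real \<Rightarrow> real \<Rightarrow> real set" where
  "winsor_tilted_means h w s =
     {winsor_tilted_mean h w M X | (M :: real measure) X. symmetric_rv_with_second_moment s M X}"

lemma winsor_tilted_mean_in_winsor_tilted_means:
  fixes M :: "'a measure"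
  assumes "symmetric_rv_with_second_moment s M X"
  shows "winsor_tilted_mean h w M X \<in> winsor_tilted_means h w s"
proof -
  let ?D = "distr M borel X"
  have X [measurable]: "X \<in> borel_measurable M"
    and sym: "?D = distr M borel (\<lambda>\<omega>. - X \<omega>)" and "prob_space M"
    and int: "integrable M (\<lambda>\<omega>. (X \<omega>)\<^sup>2)" "(\<integral>\<omega>. (X \<omega>)\<^sup>2 \<partial>M) = s"
    using assms by (auto simp: symmetric_rv_with_second_moment_def symmetric_rv_def)
  have "distr ?D borel (\<lambda>x. x) = distr ?D borel (\<lambda>x. - x)"
  proof -
    have "distr ?D borel (\<lambda>x. - x) = distr M borel (\<lambda>\<omega>. - X \<omega>)"
      by (subst distr_distr) (auto simp: comp_def)
    moreover have "distr ?D borel (\<lambda>x. x) = ?D"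
      by (subst distr_distr) (auto simp: comp_def)
    ultimately show ?thesis using sym by simp
  qed
  moreover have "prob_space ?D"
    by (rule prob_space.prob_space_distr) (use \<open>prob_space M\<close> in auto)
  ultimately have "symmetric_rv_with_second_moment s ?D (\<lambda>x. x)"
    using int
    by (simp add: symmetric_rv_with_second_moment_def symmetric_rv_def integrable_distr_eq integral_distr)
  moreover have "winsor_tilted_mean h w ?D (\<lambda>x. x) = winsor_tilted_mean h w M X"
    by (simp add: winsor_tilted_mean_def integral_distr)
  ultimately show ?thesis
    unfolding winsor_tilted_means_def by force
qed

end

theory Submission
  imports Defs
begin

text \<open>
  Write \<open>f x = x * exp (h * min x w)\<close> and \<open>g x = exp (h * min x w)\<close> for the integrands of the
  numerator and of the denominator. For symmetric \<open>X\<close> both may be replaced by their even parts.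
  Put \<open>c = sinh (h * w) / w\<close>.

  Upper bound: the even part of \<open>f\<close> is at most \<open>c * x\<^sup>2\<close>. For \<open>0 < x \<le> w\<close> this says that the slope
  \<open>sinh (h * x) / x\<close> of a chord of the convex function \<open>sinh\<close> increases up to \<open>x = w\<close>; beyond
  \<open>w\<close> the winsorisation makes the growing exponential constant, \<open>exp (h * w) - exp (- h * x)\<close> is concave in \<open>x\<close>, and
  the slope decreases (lemma \<open>winsor_odd_part_le\<close>). The even part of \<open>g\<close> is a \<open>cosh\<close>,
  hence at least 1, on \<open>[-w, w]\<close>, and it is positive elsewhere, so it is at least
  \<open>1 - x\<^sup>2 / w\<^sup>2\<close>. For \<open>\<sigma> < w\<close>, integration bounds the tilted mean by
  \<open>c * \<sigma>\<^sup>2 / (1 - \<sigma>\<^sup>2 / w\<^sup>2)\<close>.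

  Lower bound: \<open>\<bar>x\<bar> = w\<close> is where the bound on \<open>f\<close> is attained, so the mass is put there. The
  symmetric variable on \<open>{-w, 0, w}\<close> with second moment \<open>\<sigma>\<^sup>2 \<le> w\<^sup>2\<close> has tilted mean exactly
  \<open>c * \<sigma>\<^sup>2 / (1 + \<sigma>\<^sup>2 / w\<^sup>2 * (cosh (h * w) - 1))\<close>. After division by \<open>\<sigma>\<^sup>2\<close> both bounds tend
  to \<open>c\<close>.
\<close>

text \<open>Convexity of \<open>sinh\<close> on the nonnegative half-line, together with \<open>sinh 0 = 0\<close>.\<close>

lemma sinh_mult_le_mult_sinh:
  fixes t y :: real
  assumes "0 \<le> t" "t \<le> 1" "0 \<le> y"
  shows "sinh (t * y) \<le> t * sinh y"
proof -
  have "convex_on {0..} (sinh :: real \<Rightarrow> real)"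
    by (rule f''_ge0_imp_convex[where f' = cosh and f'' = sinh])
       (auto intro!: derivative_eq_intros)
  from convex_onD[OF this, of t 0 y] assms show ?thesis by simp
qed

text \<open>Both cases rest on a chord from the origin: of the convex \<open>sinh\<close> below \<open>w\<close>, and of
  the convex \<open>exp\<close> between \<open>- (h * x)\<close> and 0 beyond \<open>w\<close>.\<close>

lemma winsor_odd_part_le:
  fixes h w x :: real
  assumes h: "h > 0" and w: "w > 0" and x: "x \<ge> 0"
  shows "exp (h * min x w) - exp (h * min (- x) w) \<le> 2 * (sinh (h * w) / w) * x"
proof (cases "x \<le> w")
  case True
  have "sinh ((x / w) * (h * w)) \<le> (x / w) * sinh (h * w)"
    using True h w x by (intro sinh_mult_le_mult_sinh) auto
  moreover have "exp (h * min x w) - exp (h * min (- x) w) = 2 * sinh ((x / w) * (h * w))"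
    using True w x by (simp add: sinh_field_def min_def mult.commute)
  ultimately have "exp (h * min x w) - exp (h * min (- x) w) \<le> 2 * ((x / w) * sinh (h * w))"
    by linarith
  thus ?thesis by (simp add: mult_ac)
next
  case False
  (* weight that writes - (h * w) as a convex combination of - (h * x) and 0 *)
  define t where "t = w / x"
  have t: "0 < t" "t < 1" "t * x = w" using False w by (auto simp: t_def)
  have convex: "exp (- (h * w)) \<le> t * exp (- (h * x)) + (1 - t)"
  proof -
    have "convex_on UNIV (exp :: real \<Rightarrow> real)" by (rule exp_convex)
    from convex_onD[OF this, of t 0 "- (h * x)"] t
    have "exp (t * (- (h * x))) \<le> (1 - t) * exp 0 + t * exp (- (h * x))" by simp
    moreover have "t * (- (h * x)) = - (h * w)" using t(3) by (simp add: algebra_simps)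
    ultimately show ?thesis by (metis add.commute exp_zero mult.right_neutral)
  qed
  have "(1 - t) * 1 \<le> (1 - t) * exp (h * w)"
    using t h w by (intro mult_left_mono) auto
  with convex have "t * (exp (h * w) - exp (- (h * x))) \<le> 2 * sinh (h * w)"
    by (simp add: sinh_field_def algebra_simps)
  hence "exp (h * w) - exp (- (h * x)) \<le> 2 * sinh (h * w) / t"
    using t by (simp add: field_simps)
  also have "\<dots> = 2 * (sinh (h * w) / w) * x"
    using False w by (simp add: t_def)
  finally show ?thesis using False w by (simp add: min_def)
qed

lemma winsor_numerator_even_part_le:
  fixes h w x :: real
  assumes "h > 0" "w > 0"
  shows "x * exp (h * min x w) + (- x) * exp (h * min (- x) w) \<le> 2 * (sinh (h * w) / w) * x\<^sup>2"
proof -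
  have *: "y * exp (h * min y w) + (- y) * exp (h * min (- y) w) \<le> 2 * (sinh (h * w) / w) * y\<^sup>2"
    if "y \<ge> 0" for y
    using mult_left_mono[OF winsor_odd_part_le[OF assms that] that]
    by (simp add: power2_eq_square algebra_simps)
  show ?thesis
    using *[of x] *[of "- x"] by (cases "x \<ge> 0") (simp_all add: add.commute)
qed

lemma winsor_denominator_even_part_ge:
  fixes h w x :: real
  assumes "w > 0"
  shows "2 * (1 - x\<^sup>2 / w\<^sup>2) \<le> exp (h * min x w) + exp (h * min (- x) w)"
proof (cases "\<bar>x\<bar> \<le> w")
  case True
  hence "min x w = x" "min (- x) w = - x" by auto
  hence even_part: "exp (h * min x w) + exp (h * min (- x) w) = 2 * cosh (h * x)"
    by (simp add: cosh_field_def)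
  have "1 - x\<^sup>2 / w\<^sup>2 \<le> 1" by simp
  also have "1 \<le> cosh (h * x)" by (rule cosh_real_ge_1)
  finally show ?thesis unfolding even_part by (rule mult_left_mono) simp
next
  case False
  hence "w\<^sup>2 \<le> x\<^sup>2" using assms by (simp add: abs_le_square_iff[symmetric])
  hence "2 * (1 - x\<^sup>2 / w\<^sup>2) \<le> 0" using assms by (simp add: field_simps)
  also have "0 \<le> exp (h * min x w) + exp (h * min (- x) w)" by (intro add_nonneg_nonneg) auto
  finally show ?thesis .
qed

lemma symmetric_rv_expectation_even_part:
  fixes f :: "real \<Rightarrow> real"
  assumes X: "symmetric_rv M X" and f [measurable]: "f \<in> borel_measurable borel"
    and int: "integrable M (\<lambda>\<omega>. f (X \<omega>))"
  shows "integrable M (\<lambda>\<omega>. f (X \<omega>) + f (- X \<omega>))"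
    and "(\<integral>\<omega>. f (X \<omega>) + f (- X \<omega>) \<partial>M) = 2 * (\<integral>\<omega>. f (X \<omega>) \<partial>M)"
proof -
  have [measurable]: "X \<in> borel_measurable M"
    and eq: "distr M borel X = distr M borel (\<lambda>\<omega>. - X \<omega>)"
    using X by (auto simp: symmetric_rv_def)
  have "integrable (distr M borel X) f"
    using int by (simp add: integrable_distr_eq)
  hence int': "integrable M (\<lambda>\<omega>. f (- X \<omega>))"
    unfolding eq by (simp add: integrable_distr_eq)
  have "(\<integral>\<omega>. f (X \<omega>) \<partial>M) = integral\<^sup>L (distr M borel X) f"
    by (simp add: integral_distr)
  also have "\<dots> = (\<integral>\<omega>. f (- X \<omega>) \<partial>M)"
    unfolding eq by (simp add: integral_distr)
  finally show "(\<integral>\<omega>. f (X \<omega>) + f (- X \<omega>) \<partial>M) = 2 * (\<integral>\<omega>. f (X \<omega>) \<partial>M)"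
    using int int' by simp
  show "integrable M (\<lambda>\<omega>. f (X \<omega>) + f (- X \<omega>))" using int int' by simp
qed

lemma winsor_tilted_mean_le:
  fixes h w s :: real
  assumes h: "h > 0" and w: "w > 0" and s: "s < w\<^sup>2"
    and X: "symmetric_rv_with_second_moment s M X"
  shows "winsor_tilted_mean h w M X \<le> s * (sinh (h * w) / w / (1 - s / w\<^sup>2))"
proof -
  from X have sym: "symmetric_rv M X" and "prob_space M"
    and [measurable]: "X \<in> borel_measurable M"
    and sq: "integrable M (\<lambda>\<omega>. (X \<omega>)\<^sup>2)" and sq_eq: "(\<integral>\<omega>. (X \<omega>)\<^sup>2 \<partial>M) = s"
    by (auto simp: symmetric_rv_with_second_moment_def symmetric_rv_def)
  interpret prob_space M by fact
  let ?c = "sinh (h * w) / w"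
  let ?f = "\<lambda>x::real. x * exp (h * min x w)" and ?g = "\<lambda>x::real. exp (h * min x w)"
  have g_le: "?g x \<le> exp (h * w)" for x using h by simp
  have "integrable M X"
    by (rule square_integrable_imp_integrable) (use sq in auto)
  hence "integrable M (\<lambda>\<omega>. exp (h * w) * X \<omega>)" by simp
  hence int_f: "integrable M (\<lambda>\<omega>. ?f (X \<omega>))"
    by (rule Bochner_Integration.integrable_bound)
       (auto simp: abs_mult mult.commute intro!: mult_left_mono g_le)
  have int_g: "integrable M (\<lambda>\<omega>. ?g (X \<omega>))"
    by (rule integrable_const_bound[where B = "exp (h * w)"]) (auto simp: h)
  note f = symmetric_rv_expectation_even_part[OF sym _ int_f]
  note g = symmetric_rv_expectation_even_part[OF sym _ int_g]
  have "2 * (\<integral>\<omega>. ?f (X \<omega>) \<partial>M) = (\<integral>\<omega>. ?f (X \<omega>) + ?f (- X \<omega>) \<partial>M)"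
    by (rule f(2)[symmetric]) measurable
  also have "\<dots> \<le> (\<integral>\<omega>. 2 * ?c * (X \<omega>)\<^sup>2 \<partial>M)"
    by (intro integral_mono f(1) integrable_mult_right sq winsor_numerator_even_part_le[OF h w])
       measurable
  also have "\<dots> = 2 * ?c * s" by (simp add: sq_eq)
  finally have num: "(\<integral>\<omega>. ?f (X \<omega>) \<partial>M) \<le> ?c * s" by simp
  have "2 * (1 - s / w\<^sup>2) = (\<integral>\<omega>. 2 * (1 - (X \<omega>)\<^sup>2 / w\<^sup>2) \<partial>M)"
    using sq by (simp add: sq_eq prob_space)
  also have "\<dots> \<le> (\<integral>\<omega>. ?g (X \<omega>) + ?g (- X \<omega>) \<partial>M)"
    by (intro integral_mono g(1) winsor_denominator_even_part_ge[OF w]) (use sq in auto)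
  also have "\<dots> = 2 * (\<integral>\<omega>. ?g (X \<omega>) \<partial>M)"
    by (rule g(2)) measurable
  finally have den: "1 - s / w\<^sup>2 \<le> (\<integral>\<omega>. ?g (X \<omega>) \<partial>M)" by simp
  have pos: "1 - s / w\<^sup>2 > 0" using s w by simp
  have "s \<ge> 0" using sq_eq by (metis integral_nonneg_AE AE_I2 zero_le_power2)
  moreover have "?c \<ge> 0" using h w by simp
  ultimately have "?c * s \<ge> 0" by (intro mult_nonneg_nonneg)
  with num den pos have "(\<integral>\<omega>. ?f (X \<omega>) \<partial>M) / (\<integral>\<omega>. ?g (X \<omega>) \<partial>M) \<le> ?c * s / (1 - s / w\<^sup>2)"
    by (intro frac_le) auto
  thus ?thesis by (simp add: winsor_tilted_mean_def mult_ac)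
qed

text \<open>The extremal law: a coin with bias \<open>s / w\<^sup>2\<close> decides whether the value is nonzero, and an
  independent fair coin decides its sign. Flipping the second coin preserves the product law and
  negates the variable, which gives the symmetry.\<close>

lemma three_point_in_winsor_tilted_means:
  fixes h w s :: real
  assumes w: "w > 0" and s: "0 \<le> s" "s \<le> w\<^sup>2"
  shows "s * (sinh (h * w) / w / (1 + s / w\<^sup>2 * (cosh (h * w) - 1))) \<in> winsor_tilted_means h w s"
proof -
  define q where "q = s / w\<^sup>2"
  have q: "0 \<le> q" "q \<le> 1" using s w by (auto simp: q_def)
  have sq: "s = q * w\<^sup>2" using w by (simp add: q_def)
  define P where "P = pair_pmf (bernoulli_pmf q) (bernoulli_pmf (1/2))"
  define X :: "bool \<times> bool \<Rightarrow> real"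
    where "X = (\<lambda>(b, c). if b then (if c then w else - w) else 0)"
  define T :: "bool \<times> bool \<Rightarrow> bool \<times> bool" where "T = apsnd Not"
  have "map_pmf T P = P"
  proof (rule pmf_eqI)
    fix i
    have "inj T" by (auto simp: T_def inj_def)
    moreover have "i = T (T i)" by (cases i) (simp add: T_def)
    ultimately have "pmf (map_pmf T P) i = pmf P (T i)" by (metis pmf_map_inj')
    also have "\<dots> = pmf P i" by (cases i) (auto simp: P_def T_def pmf_pair pmf_bernoulli_half split: bool.split)
    finally show "pmf (map_pmf T P) i = pmf P i" .
  qed
  hence "distr P borel X = distr (map_pmf T P) borel X" by simp
  also have "\<dots> = distr P borel (X \<circ> T)"
    unfolding map_pmf_rep_eq by (rule distr_distr) auto
  also have "X \<circ> T = (\<lambda>\<omega>. - X \<omega>)" by (auto simp: X_def T_def)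
  finally have "symmetric_rv P X" by (simp add: symmetric_rv_def)
  moreover have E: "(\<integral>\<omega>. f (X \<omega>) \<partial>P) = q / 2 * (f w + f (- w)) + (1 - q) * f 0"
    for f :: "real \<Rightarrow> real"
  proof -
    have "(\<integral>\<omega>. f (X \<omega>) \<partial>P) = (\<Sum>\<omega>\<in>UNIV. f (X \<omega>) * pmf P \<omega>)"
      by (rule integral_measure_pmf_real) auto
    thus ?thesis
      using q by (simp add: UNIV_Times_UNIV[symmetric] UNIV_bool P_def X_def pmf_pair algebra_simps
          del: UNIV_Times_UNIV)
  qed
  ultimately have "symmetric_rv_with_second_moment s P X"
    unfolding symmetric_rv_with_second_moment_def
    using E[of "\<lambda>x. x\<^sup>2"]
    by (auto simp: prob_space_measure_pmf sq intro: integrable_measure_pmf_finite)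
  hence "winsor_tilted_mean h w P X \<in> winsor_tilted_means h w s"
    by (rule winsor_tilted_mean_in_winsor_tilted_means)
  moreover have "winsor_tilted_mean h w P X = s * (sinh (h * w) / w / (1 + s / w\<^sup>2 * (cosh (h * w) - 1)))"
  proof -
    have "(\<integral>\<omega>. X \<omega> * exp (h * min (X \<omega>) w) \<partial>P)
        = q / 2 * (w * exp (h * w) + - w * exp (- (h * w)))"
      using E[of "\<lambda>x. x * exp (h * min x w)"] w by simp
    also have "\<dots> = q * w * sinh (h * w)"
      by (simp add: sinh_field_def algebra_simps)
    also have "\<dots> = s * (sinh (h * w) / w)"
      using w by (simp add: sq power2_eq_square)
    finally have "(\<integral>\<omega>. X \<omega> * exp (h * min (X \<omega>) w) \<partial>P) = s * (sinh (h * w) / w)" .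
    moreover have "(\<integral>\<omega>. exp (h * min (X \<omega>) w) \<partial>P) = 1 + s / w\<^sup>2 * (cosh (h * w) - 1)"
      using E[of "\<lambda>x. exp (h * min x w)"] w
      by (simp add: q_def[symmetric] cosh_field_def algebra_simps)
    ultimately show ?thesis by (simp add: winsor_tilted_mean_def)
  qed
  ultimately show ?thesis by simp
qed

theorem mainTheorem2:
  fixes h w :: real
  assumes "h > 0" and "w > 0"
  shows "((\<lambda>\<sigma>::real. ereal (1 / \<sigma>\<^sup>2) * (SUP m\<in>winsor_tilted_means h w (\<sigma>\<^sup>2). ereal m))
           \<longlongrightarrow> ereal (sinh (h * w) / w)) (at_right 0)"
proof (rule tendsto_sandwich)
  let ?c = "sinh (h * w) / w"
  let ?L = "\<lambda>\<sigma>::real. ?c / (1 + \<sigma>\<^sup>2 / w\<^sup>2 * (cosh (h * w) - 1))"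
  let ?U = "\<lambda>\<sigma>::real. ?c / (1 - \<sigma>\<^sup>2 / w\<^sup>2)"
  let ?S = "\<lambda>\<sigma>::real. SUP m\<in>winsor_tilted_means h w (\<sigma>\<^sup>2). ereal m"
  have ev: "eventually (\<lambda>\<sigma>. \<sigma> \<in> {0<..<w}) (at_right 0)"
    using \<open>w > 0\<close> by (rule eventually_at_right_real)
  have cancel: "ereal (1 / \<sigma>\<^sup>2) * ereal (\<sigma>\<^sup>2 * a) = ereal a" if "\<sigma> > 0" for \<sigma> a :: real
    using that by simp
  show "\<forall>\<^sub>F \<sigma> in at_right 0. ereal (?L \<sigma>) \<le> ereal (1 / \<sigma>\<^sup>2) * ?S \<sigma>"
    using ev
  proof eventually_elim
    case (elim \<sigma>)
    hence "\<sigma>\<^sup>2 \<le> w\<^sup>2" by (intro power_mono) auto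
    hence "\<sigma>\<^sup>2 * ?L \<sigma> \<in> winsor_tilted_means h w (\<sigma>\<^sup>2)"
      using \<open>w > 0\<close> by (intro three_point_in_winsor_tilted_means) auto
    hence "ereal (\<sigma>\<^sup>2 * ?L \<sigma>) \<le> ?S \<sigma>" by (rule SUP_upper)
    hence "ereal (1 / \<sigma>\<^sup>2) * ereal (\<sigma>\<^sup>2 * ?L \<sigma>) \<le> ereal (1 / \<sigma>\<^sup>2) * ?S \<sigma>"
      by (rule ereal_mult_left_mono) simp
    thus ?case using cancel[of \<sigma> "?L \<sigma>"] elim by simp
  qed
  show "\<forall>\<^sub>F \<sigma> in at_right 0. ereal (1 / \<sigma>\<^sup>2) * ?S \<sigma> \<le> ereal (?U \<sigma>)"
    using ev
  proof eventually_elim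
    case (elim \<sigma>)
    hence "\<sigma>\<^sup>2 < w\<^sup>2" by (intro power_strict_mono) auto
    hence "?S \<sigma> \<le> ereal (\<sigma>\<^sup>2 * ?U \<sigma>)"
      using winsor_tilted_mean_le[OF assms]
      by (intro SUP_least) (auto simp: winsor_tilted_means_def simp del: times_divide_eq_right)
    hence "ereal (1 / \<sigma>\<^sup>2) * ?S \<sigma> \<le> ereal (1 / \<sigma>\<^sup>2) * ereal (\<sigma>\<^sup>2 * ?U \<sigma>)"
      by (rule ereal_mult_left_mono) simp
    thus ?case using cancel[of \<sigma> "?U \<sigma>"] elim by simp
  qed
  have "((\<lambda>\<sigma>. ?L \<sigma>) \<longlongrightarrow> ?c / (1 + 0\<^sup>2 / w\<^sup>2 * (cosh (h * w) - 1))) (at_right 0)"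
    using \<open>w > 0\<close> by (intro tendsto_intros) auto
  thus "((\<lambda>\<sigma>. ereal (?L \<sigma>)) \<longlongrightarrow> ereal ?c) (at_right 0)" by simp
  have "((\<lambda>\<sigma>. ?U \<sigma>) \<longlongrightarrow> ?c / (1 - 0\<^sup>2 / w\<^sup>2)) (at_right 0)"
    using \<open>w > 0\<close> by (intro tendsto_intros) auto
  thus "((\<lambda>\<sigma>. ereal (?U \<sigma>)) \<longlongrightarrow> ereal ?c) (at_right 0)" by simp
qed

end
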